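(* Let $\mathbf{u}_{(0)}$ be a feasible point of the centralized MPC problem (C), and let $\{\mathbf{u}_{(p)}\}_{p\ge 0}$ be generated from it by the Jacobi iteration (J) with weights $\lambda^1,\dots,\lambda^M\in(0,1)$, $\sum_{i=1}^M\lambda^i=1$ (problem (C), the local problems and iteration (J) are defined in the context). Then for every $p\ge1$, each $\mathbf{u}_{(p)}$ is a feasible solution of (C), and it is also feasible for the local problem of subsystem $i$ with assumed sequence $\mathbf{u}_{(p)}$, for all $i=1,\dots,M$.
   Context: Plant: there are $M$ subsystems with states $x^i\in\mathbb{R}^{n_i}$, inputs $u^i\in\mathbb{R}^{m_i}$ and dynamics $x^i_{t+1}=\sum_{j=1}^M(A_{ij}x^j_t+B_{ij}u^j_t)$. With $x=(x^1,\dots,x^M)$, $u=(u^1,\dots,u^M)$, $A=(A_{ij})$, $B=(B_{ij})$, this reads $x_{t+1}=Ax_t+Bu_t$; the pair $(A,B)$ is stabilizable. Neighborhoods: $\mathcal{N}^i\subseteq\{1,\dots,M\}$ denotes the set consisting of $i$ and all indices of subsystems having a direct dynamical coupling or a direct constraint coupling with subsystem $i$; thus $i\in\mathcal{N}^i$, and $j\in\mathcal{N}^i\Leftrightarrow i\in\mathcal{N}^j$. For a vector $w=(w^1,\dots,w^M)$, $w^{+i}$ denotes the collection of components $w^j$ with $j\in\mathcal{N}^i$, and $w^{\bar i}$ the collection of components with $j\notin\mathcal{N}^i$. Constraints: for each $i$ there are convex coupled constraints $x^{+i}\in\mathcal{X}^{+i}(x^{\bar i})$, $u^{+i}\in\mathcal{U}^{+i}(u^{\bar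 i})$, with closed convex sets parameterized by the components outside $\mathcal{N}^i$. The sets $\mathcal{X}$ and $\mathcal{U}$ are the closed convex sets of all full vectors $x$, respectively $u$, satisfying these constraints for all $i=1,\dots,M$. Cost: $N\ge1$ is the prediction horizon, $Q=\mathrm{diag}(Q_1,\dots,Q_M)$ and $R=\mathrm{diag}(R_1,\dots,R_M)$ are block diagonal with $Q_i$ (symmetric) positive semidefinite and $R_i$ (symmetric) positive definite. For an input sequence $\mathbf{u}=(u_0,\dots,u_{N-1})$ and fixed initial state $x_0$, let $x_{k+1}=Ax_k+Bu_k$ and $V(\mathbf{u},x_0)=\sum_{k=0}^{N-1}\left(x_k^TQx_k+u_k^TRu_k\right)$. Centralized MPC problem (C): minimize $V(\mathbf{u},x_0)$ over $\mathbf{u}$ subject to $u_k\in\mathcal{U}$ for $k=0,\dots,N-1$, $x_k\in\mathcal{X}$ for $k=1,\dots,N$, and $x_N=0$. Local problem of subsystem $i$, given an assumed sequence $\hat{\mathbf{u}}$: minimize $V(\mathbf{u},x_0)$ subject to all constraints of (C) and $\mathbf{u}^{\bar i}=\hat{\mathbf{u}}^{\bar i}$, where $\mathbf{u}^j=(u^j_0,\dots,u^j_{N-1})$ is the input sequence of subsystem $j$. Jacobi iteration (J): for $p=1,2,\dots$, let $\mathbf{u}^{s|i}_{(p)}$ be the (full) minimizer of the local problem of subsystem $i$ with assumed sequence $\hat{\mathbf{u}}=\mathbf{u}_{(p-1)}$, and set $\mathbf{u}_{(p)}=\sum_{i=1}^M\lambda^i\,\mathbf{u}^{s|i}_{(p)}$.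 *)

theory Defs
  imports "HOL-Analysis.Analysis"
begin

(* The M subsystems are the elements of a finite type 'i.  The full state and input live in
   real^'n and real^'m, and a map from coordinates to 'i says which subsystem owns each
   coordinate; so n_i is the number of state coordinates owned by i, and the block A_ij of A
   consists of the entries whose row is owned by i and whose column is owned by j. *)

(* The subvector of the components of w owned by subsystems in S, padded with zeros.  The padding
   is a linear isometry, so it preserves closedness and convexity of sets of subvectors. *)
definition restr :: "('a::finite \<Rightarrow> 'i) \<Rightarrow> 'i set \<Rightarrow> real ^ 'a \<Rightarrow> real ^ 'a" where
  "restr own S w = (\<chi> a. if own a \<in> S then w $ a else 0)"

definition block_nonzero ::
  "('a::finite \<Rightarrow> 'i) \<Rightarrow> ('b::finite \<Rightarrow> 'i) \<Rightarrow> real ^ 'b ^ 'a \<Rightarrow> 'i \<Rightarrow> 'i \<Rightarrow> bool" where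
  "block_nonzero rown cown Z i j \<longleftrightarrow> (\<exists>a b. rown a = i \<and> cown b = j \<and> Z $ a $ b \<noteq> 0)"

definition block_diagonal :: "('a::finite \<Rightarrow> 'i) \<Rightarrow> real ^ 'a ^ 'a \<Rightarrow> bool" where
  "block_diagonal own Z \<longleftrightarrow> (\<forall>i j. i \<noteq> j \<longrightarrow> \<not> block_nonzero own own Z i j)"

definition schur_stable :: "real ^ 'n ^ 'n \<Rightarrow> bool" where
  "schur_stable F \<longleftrightarrow>
     (\<forall>(z::complex) v. v \<noteq> 0 \<and> map_matrix complex_of_real F *v v = z *s v \<longrightarrow> cmod z < 1)"

definition stabilizable :: "real ^ 'n ^ 'n \<Rightarrow> real ^ 'm ^ 'n \<Rightarrow> bool" where
  "stabilizable F G \<longleftrightarrow> (\<exists>K :: real ^ 'n ^ 'm. schur_stable (F + G ** K))"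

(* ccoupled is the relation "there is a direct constraint coupling".
   xcon i w and ucon i w are the sets X^{+i}(w) and U^{+i}(w), whose elements and whose
   parameter w are zero-padded subvectors. *)
record ('i, 'n::finite, 'm::finite) dmpc =
  xown :: "'n \<Rightarrow> 'i"
  uown :: "'m \<Rightarrow> 'i"
  Amat :: "real ^ 'n ^ 'n"
  Bmat :: "real ^ 'm ^ 'n"
  ccoupled :: "'i \<Rightarrow> 'i \<Rightarrow> bool"
  xcon :: "'i \<Rightarrow> real ^ 'n \<Rightarrow> (real ^ 'n) set"
  ucon :: "'i \<Rightarrow> real ^ 'm \<Rightarrow> (real ^ 'm) set"
  Qmat :: "real ^ 'n ^ 'n"
  Rmat :: "real ^ 'm ^ 'm"
  horizon :: nat

definition dyn_coupled :: "('i, 'n::finite, 'm::finite) dmpc \<Rightarrow> 'i \<Rightarrow> 'i \<Rightarrow> bool" where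
  "dyn_coupled P i j \<longleftrightarrow>
     block_nonzero (xown P) (xown P) (Amat P) i j \<or> block_nonzero (xown P) (uown P) (Bmat P) i j \<or>
     block_nonzero (xown P) (xown P) (Amat P) j i \<or> block_nonzero (xown P) (uown P) (Bmat P) j i"

definition neigh :: "('i, 'n::finite, 'm::finite) dmpc \<Rightarrow> 'i \<Rightarrow> 'i set" where
  "neigh P i = insert i {j. dyn_coupled P i j \<or> ccoupled P i j}"

definition Xset :: "('i, 'n::finite, 'm::finite) dmpc \<Rightarrow> (real ^ 'n) set" where
  "Xset P = {x. \<forall>i. restr (xown P) (neigh P i) x \<in> xcon P i (restr (xown P) (- neigh P i) x)}"

definition Uset :: "('i, 'n::finite, 'm::finite) dmpc \<Rightarrow> (real ^ 'm) set" where
  "Uset P = {u. \<forall>i. restr (uown P) (neigh P i) u \<in> ucon P i (restr (uown P) (- neigh P i) u)}"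

locale dmpc_setup =
  fixes P :: "('i::finite, 'n::finite, 'm::finite) dmpc"
  assumes stab: "stabilizable (Amat P) (Bmat P)"
    and ccoupled_sym: "symp (ccoupled P)"
    and xcon_subvectors: "\<And>i w. xcon P i w \<subseteq> range (restr (xown P) (neigh P i))"
    and xcon_closed: "\<And>i x. closed (xcon P i (restr (xown P) (- neigh P i) x))"
    and xcon_convex: "\<And>i x. convex (xcon P i (restr (xown P) (- neigh P i) x))"
    and ucon_subvectors: "\<And>i w. ucon P i w \<subseteq> range (restr (uown P) (neigh P i))"
    and ucon_closed: "\<And>i u. closed (ucon P i (restr (uown P) (- neigh P i) u))"
    and ucon_convex: "\<And>i u. convex (ucon P i (restr (uown P) (- neigh P i) u))"
    and X_closed: "closed (Xset P)" and X_convex: "convex (Xset P)"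
    and U_closed: "closed (Uset P)" and U_convex: "convex (Uset P)"
    and horizon_pos: "horizon P \<ge> 1"
    and Q_diag: "block_diagonal (xown P) (Qmat P)"
    and Q_sym: "transpose (Qmat P) = Qmat P"
    and Q_psd: "\<And>i x. 0 \<le> restr (xown P) {i} x \<bullet> (Qmat P *v restr (xown P) {i} x)"
    and R_diag: "block_diagonal (uown P) (Rmat P)"
    and R_sym: "transpose (Rmat P) = Rmat P"
    and R_pd: "\<And>i u. restr (uown P) {i} u \<noteq> 0 \<Longrightarrow>
                 0 < restr (uown P) {i} u \<bullet> (Rmat P *v restr (uown P) {i} u)"

primrec traj ::
  "('i, 'n::finite, 'm::finite) dmpc \<Rightarrow> real ^ 'n \<Rightarrow> (nat \<Rightarrow> real ^ 'm) \<Rightarrow> nat \<Rightarrow> real ^ 'n" where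
  "traj P x0 u 0 = x0"
| "traj P x0 u (Suc k) = Amat P *v traj P x0 u k + Bmat P *v u k"

definition cost :: "('i, 'n::finite, 'm::finite) dmpc \<Rightarrow> real ^ 'n \<Rightarrow> (nat \<Rightarrow> real ^ 'm) \<Rightarrow> real" where
  "cost P x0 u =
     (\<Sum>k<horizon P. traj P x0 u k \<bullet> (Qmat P *v traj P x0 u k) + u k \<bullet> (Rmat P *v u k))"

(* Input sequences (u_0, ..., u_{N-1}), represented as functions vanishing from N on. *)
definition input_seqs :: "('i, 'n::finite, 'm::finite) dmpc \<Rightarrow> (nat \<Rightarrow> real ^ 'm) set" where
  "input_seqs P = {u. \<forall>k\<ge>horizon P. u k = 0}"

definition central_feasible ::
  "('i, 'n::finite, 'm::finite) dmpc \<Rightarrow> real ^ 'n \<Rightarrow> (nat \<Rightarrow> real ^ 'm) \<Rightarrow> bool" where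
  "central_feasible P x0 u \<longleftrightarrow>
     u \<in> input_seqs P \<and>
     (\<forall>k<horizon P. u k \<in> Uset P) \<and>
     (\<forall>k\<in>{1..horizon P}. traj P x0 u k \<in> Xset P) \<and>
     traj P x0 u (horizon P) = 0"

definition local_feasible ::
  "('i, 'n::finite, 'm::finite) dmpc \<Rightarrow> real ^ 'n \<Rightarrow> 'i \<Rightarrow> (nat \<Rightarrow> real ^ 'm) \<Rightarrow> (nat \<Rightarrow> real ^ 'm) \<Rightarrow> bool"
where
  "local_feasible P x0 i uhat u \<longleftrightarrow>
     central_feasible P x0 u \<and>
     (\<forall>k<horizon P. restr (uown P) (- neigh P i) (u k) = restr (uown P) (- neigh P i) (uhat k))"

(* arg_min is a choice operator; the minimizer of a feasible local problem exists and is unique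
   because the R_i are positive definite, the Q_i positive semidefinite, and the feasible set is
   closed and convex. *)
definition local_solution ::
  "('i, 'n::finite, 'm::finite) dmpc \<Rightarrow> real ^ 'n \<Rightarrow> 'i \<Rightarrow> (nat \<Rightarrow> real ^ 'm) \<Rightarrow> (nat \<Rightarrow> real ^ 'm)" where
  "local_solution P x0 i uhat = arg_min (cost P x0) (local_feasible P x0 i uhat)"

definition jacobi_step ::
  "('i::finite, 'n::finite, 'm::finite) dmpc \<Rightarrow> real ^ 'n \<Rightarrow> ('i \<Rightarrow> real) \<Rightarrow>
   (nat \<Rightarrow> real ^ 'm) \<Rightarrow> (nat \<Rightarrow> real ^ 'm)" where
  "jacobi_step P x0 lam u = (\<lambda>k. \<Sum>i\<in>UNIV. lam i *\<^sub>R local_solution P x0 i u k)"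

end

theory Submission
  imports Defs
begin

text \<open>
  Every minimizer of a local problem satisfies all constraints of the centralized problem, so
  the Jacobi update is a convex combination of centrally feasible input sequences. The state
  trajectory depends affinely on the input sequence and the constraint sets are convex, so the
  centrally feasible sequences are closed under convex combinations
  (\<open>central_feasible_convex_sum\<close>). Feasibility is therefore inherited from each iterate by the
  next. Feasibility for the local problem with the iterate itself as assumed sequence then
  holds because the coordinates outside the neighborhood are compared with themselves.

  What remains is that the local minimizers exist, since \<open>local_solution\<close> is a choice and would
  otherwise be an arbitrary sequence (\<open>local_feasible_local_solution\<close>). The assumed sequence
  is a feasible candidate for the local problem. Because \<open>R\<close> is positive definite and the other
  cost terms are nonnegative, a competitor of no larger cost has all its inputs in a fixed ball.
  In the product topology on sequences, the sequences of inputs in that ball that vanish beyond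
  the horizon form a compact set, the feasible set is closed, and the cost is continuous, so the
  minimum is attained.
\<close>

section \<open>Quadratic forms of block diagonal matrices\<close>

lemma linear_restr: "linear (restr own S)"
  by (rule linearI) (auto simp: restr_def vec_eq_iff)

lemma sum_restr_singletons:
  fixes own :: "'a::finite \<Rightarrow> 'i::finite"
  shows "(\<Sum>i\<in>UNIV. restr own {i} w) = w"
  by (simp add: restr_def vec_eq_iff)

lemma block_diagonal_cross_term:
  assumes "block_diagonal own Z" "i \<noteq> j"
  shows "restr own {i} v \<bullet> (Z *v restr own {j} w) = 0"
proof -
  have "restr own {i} v $ a * (Z $ a $ b * restr own {j} w $ b) = 0" for a b
    using assms by (fastforce simp: restr_def block_diagonal_def block_nonzero_def)
  then show ?thesis
    unfolding inner_vec_def matrix_vector_mult_def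
    by (simp only: vec_lambda_beta inner_real_def sum_distrib_left sum.neutral_const)
qed

lemma block_diagonal_quadratic_form:
  fixes own :: "'a::finite \<Rightarrow> 'i::finite"
  assumes "block_diagonal own Z"
  shows "v \<bullet> (Z *v v) = (\<Sum>i\<in>UNIV. restr own {i} v \<bullet> (Z *v restr own {i} v))"
proof -
  have "v \<bullet> (Z *v v) =
      (\<Sum>i\<in>UNIV. restr own {i} v) \<bullet> (Z *v (\<Sum>j\<in>UNIV. restr own {j} v))"
    by (simp add: sum_restr_singletons)
  also have "\<dots> = (\<Sum>i\<in>UNIV. \<Sum>j\<in>UNIV. restr own {i} v \<bullet> (Z *v restr own {j} v))"
    by (simp add: linear_sum[OF matrix_vector_mul_linear] inner_sum_left inner_sum_right)
      (rule sum.swap)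
  also have "\<dots> = (\<Sum>i\<in>UNIV. \<Sum>j\<in>UNIV.
      if j = i then restr own {i} v \<bullet> (Z *v restr own {i} v) else 0)"
    by (intro sum.cong refl) (auto simp: block_diagonal_cross_term[OF assms])
  finally show ?thesis
    by simp
qed

lemma continuous_on_matrix_vector_mult [continuous_intros]:
  fixes Z :: "real ^ 'n ^ 'm"
  shows "continuous_on S f \<Longrightarrow> continuous_on S (\<lambda>x. Z *v f x)"
  by (rule bounded_linear.continuous_on[OF matrix_vector_mul_bounded_linear])

text \<open>
  By homogeneity it suffices to look at the unit sphere, where the form has a positive minimum.
\<close>

lemma positive_definite_coercive:
  fixes Z :: "real ^ 'm ^ 'm"
  assumes pos: "\<And>v. v \<noteq> 0 \<Longrightarrow> 0 < v \<bullet> (Z *v v)"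
  obtains a where "0 < a" "\<And>v. a * (norm v)\<^sup>2 \<le> v \<bullet> (Z *v v)"
proof -
  let ?S = "sphere (0 :: real ^ 'm) 1"
  have ne: "?S \<noteq> {}"
    by simp
  have "continuous_on ?S (\<lambda>v. v \<bullet> (Z *v v))"
    by (intro continuous_intros)
  from continuous_attains_inf[OF compact_sphere ne this]
  obtain w where w: "norm w = 1" and min: "\<And>v. norm v = 1 \<Longrightarrow> w \<bullet> (Z *v w) \<le> v \<bullet> (Z *v v)"
    by auto
  show thesis
  proof (rule that)
    show "0 < w \<bullet> (Z *v w)"
      using w pos[of w] by force
    show "(w \<bullet> (Z *v w)) * (norm v)\<^sup>2 \<le> v \<bullet> (Z *v v)" for v
    proof (cases "v = 0")
      case False
      define e where "e = (1 / norm v) *\<^sub>R v"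
      have e: "norm e = 1" "v = norm v *\<^sub>R e"
        using False by (simp_all add: e_def)
      have "v \<bullet> (Z *v v) = (norm v)\<^sup>2 * (e \<bullet> (Z *v e))"
        by (subst (1 2) e(2)) (simp add: matrix_vector_mult_scaleR power2_eq_square)
      then show ?thesis
        using min[OF e(1)] by (simp add: mult.commute mult_right_mono)
    qed simp
  qed
qed

section \<open>Affine dependence of trajectories on inputs\<close>

lemma traj_affine_sum:
  assumes "sum lam I = 1"
  shows "traj P x0 (\<lambda>k. \<Sum>i\<in>I. lam i *\<^sub>R w i k) k = (\<Sum>i\<in>I. lam i *\<^sub>R traj P x0 (w i) k)"
proof (induction k)
  case 0
  then show ?case
    using assms by (simp flip: scaleR_left.sum)
next
  case (Suc k)
  then show ?case
    by (simp add: linear_sum[OF matrix_vector_mul_linear] matrix_vector_mult_scaleR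
        scaleR_add_right sum.distrib)
qed

lemma central_feasible_convex_sum:
  assumes "dmpc_setup P" "finite I" "\<And>i. i \<in> I \<Longrightarrow> 0 \<le> lam i" "sum lam I = 1"
    and feas: "\<And>i. i \<in> I \<Longrightarrow> central_feasible P x0 (w i)"
  shows "central_feasible P x0 (\<lambda>k. \<Sum>i\<in>I. lam i *\<^sub>R w i k)"
proof -
  interpret dmpc_setup P by fact
  show ?thesis
    unfolding central_feasible_def traj_affine_sum[OF assms(4)]
  proof (intro conjI allI ballI impI)
    show "(\<lambda>k. \<Sum>i\<in>I. lam i *\<^sub>R w i k) \<in> input_seqs P"
      using feas by (auto simp: central_feasible_def input_seqs_def)
    show "(\<Sum>i\<in>I. lam i *\<^sub>R w i k) \<in> Uset P" if "k < horizon P" for k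
      using assms that by (intro convex_sum[OF _ U_convex]) (auto simp: central_feasible_def)
    show "(\<Sum>i\<in>I. lam i *\<^sub>R traj P x0 (w i) k) \<in> Xset P" if "k \<in> {1..horizon P}" for k
      using assms that by (intro convex_sum[OF _ X_convex]) (auto simp: central_feasible_def)
    show "(\<Sum>i\<in>I. lam i *\<^sub>R traj P x0 (w i) (horizon P)) = 0"
      using feas by (intro sum.neutral) (auto simp: central_feasible_def)
  qed
qed

section \<open>Existence of local minimizers\<close>

lemma continuous_on_input [continuous_intros]:
  "continuous_on UNIV (\<lambda>u. (u :: nat \<Rightarrow> real ^ 'm) k)"
  by (rule continuous_on_product_coordinates)

lemma continuous_on_traj [continuous_intros]:
  "continuous_on UNIV (\<lambda>u. traj P x0 u k)"
  by (induction k) (auto intro!: continuous_intros)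

lemma continuous_on_cost: "continuous_on UNIV (cost P x0)"
  unfolding cost_def by (intro continuous_intros)

lemma closed_local_feasible:
  assumes "dmpc_setup P"
  shows "closed {v. local_feasible P x0 i uhat v}"
proof -
  interpret dmpc_setup P by fact
  have restr: "continuous_on UNIV (\<lambda>v. restr (uown P) S (v k))" for S and k :: nat
    using continuous_on_input
    by (rule bounded_linear.continuous_on[OF linear_linear[THEN iffD2, OF linear_restr]])
  have U: "closed {v. v k \<in> Uset P}" for k :: nat
    using closed_vimage[OF U_closed continuous_on_input] by (simp add: vimage_def)
  have X: "closed {v. traj P x0 v k \<in> Xset P}" for k
    using closed_vimage[OF X_closed continuous_on_traj] by (simp add: vimage_def)
  show ?thesis
    unfolding local_feasible_def central_feasible_def input_seqs_def mem_Collect_eq Ball_def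
    by (intro closed_Collect_conj closed_Collect_all closed_Collect_imp open_Collect_const
        U X closed_Collect_eq continuous_on_const continuous_on_input continuous_on_traj restr)
qed

text \<open>
  The other stage costs are nonnegative, so one input of large norm already makes the total cost
  large.
\<close>

lemma cost_sublevel_bounded:
  assumes "dmpc_setup P"
  obtains r where "\<And>v k. cost P x0 v \<le> c \<Longrightarrow> k < horizon P \<Longrightarrow> norm (v k) \<le> r"
proof -
  interpret dmpc_setup P by fact
  have Q: "0 \<le> x \<bullet> (Qmat P *v x)" for x
    by (subst block_diagonal_quadratic_form[OF Q_diag]) (intro sum_nonneg Q_psd)
  have R: "0 < v \<bullet> (Rmat P *v v)" if "v \<noteq> 0" for v
  proof -
    have nonneg: "0 \<le> restr (uown P) {i} v \<bullet> (Rmat P *v restr (uown P) {i} v)" for i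
      using R_pd[of i v] by (cases "restr (uown P) {i} v = 0") auto
    have "(\<Sum>i\<in>UNIV. restr (uown P) {i} v) \<noteq> 0"
      using that by (simp add: sum_restr_singletons)
    then obtain i where "restr (uown P) {i} v \<noteq> 0"
      by (blast elim: sum.not_neutral_contains_not_neutral)
    then show ?thesis
      by (subst block_diagonal_quadratic_form[OF R_diag])
        (auto intro!: sum_pos2[where i = i] R_pd nonneg)
  qed
  obtain a where a: "0 < a" "\<And>v. a * (norm v)\<^sup>2 \<le> v \<bullet> (Rmat P *v v)"
    using positive_definite_coercive[OF R] by blast
  show thesis
  proof (rule that)
    fix v k assume v: "cost P x0 v \<le> c" and k: "k < horizon P"
    have R0: "0 \<le> w \<bullet> (Rmat P *v w)" for w
      using R[of w] by (cases "w = 0") auto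
    let ?l = "\<lambda>k. traj P x0 v k \<bullet> (Qmat P *v traj P x0 v k) + v k \<bullet> (Rmat P *v v k)"
    have "a * (norm (v k))\<^sup>2 \<le> ?l k"
      using a(2)[of "v k"] Q[of "traj P x0 v k"] by linarith
    also have "\<dots> \<le> cost P x0 v"
      unfolding cost_def using k Q R0 by (intro member_le_sum) auto
    finally have "(norm (v k))\<^sup>2 \<le> c / a"
      using v a(1) by (simp add: field_simps)
    then show "norm (v k) \<le> sqrt (c / a)"
      by (rule real_le_rsqrt)
  qed
qed

lemma local_minimizer_exists:
  fixes P :: "('i::finite, 'n::finite, 'm::finite) dmpc"
  assumes "dmpc_setup P" and feas: "local_feasible P x0 i uhat w"
  shows "\<exists>v. is_arg_min (cost P x0) (local_feasible P x0 i uhat) v"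
proof -
  obtain r where r: "\<And>v k. cost P x0 v \<le> cost P x0 w \<Longrightarrow> k < horizon P \<Longrightarrow> norm (v k) \<le> r"
    using cost_sublevel_bounded[OF assms(1)] by blast
  let ?F = "{v. local_feasible P x0 i uhat v}"
  define K where "K = PiE UNIV (\<lambda>k. if k < horizon P then cball (0 :: real ^ 'm) r else {0})"
  have "compactin (product_topology (\<lambda>k. euclidean) UNIV) K"
    unfolding K_def compactin_PiE by simp
  then have "compact K"
    by (simp add: euclidean_product_topology)
  then have compact: "compact (K \<inter> ?F)"
    by (rule compact_Int_closed[OF _ closed_local_feasible[OF assms(1)]])
  have sublevel: "v \<in> K \<inter> ?F" if "local_feasible P x0 i uhat v" "cost P x0 v \<le> cost P x0 w" for v
    using that r[of v] by (auto simp: K_def local_feasible_def central_feasible_def input_seqs_def)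
  then have "K \<inter> ?F \<noteq> {}"
    using feas by blast
  then obtain v where v: "v \<in> K \<inter> ?F" and min: "\<And>v'. v' \<in> K \<inter> ?F \<Longrightarrow> cost P x0 v \<le> cost P x0 v'"
    using continuous_attains_inf[OF compact _ continuous_on_subset[OF continuous_on_cost subset_UNIV]]
    by metis
  have "cost P x0 v \<le> cost P x0 v'" if "local_feasible P x0 i uhat v'" for v'
    using min[of v'] min[of w] sublevel[of v'] sublevel[of w] that feas by linarith
  then show ?thesis
    using v by (auto simp: is_arg_min_linorder)
qed

lemma local_feasible_local_solution:
  assumes "dmpc_setup P" "central_feasible P x0 uhat"
  shows "local_feasible P x0 i uhat (local_solution P x0 i uhat)"
proof -
  have "local_feasible P x0 i uhat uhat"
    using assms(2) by (simp add: local_feasible_def)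
  from local_minimizer_exists[OF assms(1) this] show ?thesis
    unfolding local_solution_def arg_min_def
    by (metis (no_types, lifting) is_arg_min_def someI_ex)
qed

section \<open>The Jacobi iteration\<close>

lemma central_feasible_jacobi_step:
  assumes "dmpc_setup P" "\<And>i. 0 \<le> lam i" "sum lam UNIV = 1" "central_feasible P x0 w"
  shows "central_feasible P x0 (jacobi_step P x0 lam w)"
proof -
  have "central_feasible P x0 (local_solution P x0 i w)" for i
    using local_feasible_local_solution[OF assms(1,4)] by (simp add: local_feasible_def)
  then show ?thesis
    unfolding jacobi_step_def using assms(1-3) by (intro central_feasible_convex_sum) auto
qed

theorem mainTheorem3:
  fixes P :: "('i::finite, 'n::finite, 'm::finite) dmpc"
    and x0 :: "real ^ 'n"
    and lam :: "'i \<Rightarrow> real"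
    and u :: "nat \<Rightarrow> nat \<Rightarrow> real ^ 'm"
  assumes "dmpc_setup P"
    and "\<And>i. 0 < lam i \<and> lam i < 1"
    and "(\<Sum>i\<in>UNIV. lam i) = 1"
    and "central_feasible P x0 (u 0)"
    and "\<And>p. p \<ge> 1 \<Longrightarrow> u p = jacobi_step P x0 lam (u (p - 1))"
  shows "\<forall>p\<ge>1. central_feasible P x0 (u p) \<and> (\<forall>i. local_feasible P x0 i (u p) (u p))"
proof -
  have "central_feasible P x0 (u p)" for p
  proof (induction p)
    case 0
    show ?case by fact
  next
    case (Suc p)
    then have "central_feasible P x0 (jacobi_step P x0 lam (u p))"
      using assms(1-3) by (intro central_feasible_jacobi_step) (auto simp: less_imp_le)
    then show ?case
      using assms(5)[of "Suc p"] by simp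
  qed
  then show ?thesis
    by (simp add: local_feasible_def)
qed

end
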